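(* Let $V\in C^{1}(\mathbb{R}^{N}\setminus\{0\},\mathbb{R})$ satisfy: (1) $V(-x)=V(x)$ for all $x\in\mathbb{R}^{N}\setminus\{0\}$; (2) there is a constant $\alpha\in(0,2)$ such that $(x,\nabla V(x))=-\alpha V(x)<0$ for every $x\in\mathbb{R}^{N}\setminus\{0\}$. Then for every $H>0$ there is at least one hyperbolic orbit of the system $$\ddot u(t)+\nabla V(u(t))=0,\qquad \tfrac12|\dot u(t)|^{2}+V(u(t))=H .$$
   Context: $(\cdot,\cdot)$ denotes the standard Euclidean inner product on $\mathbb{R}^{N}$, $|\cdot|$ the induced norm, and $\nabla V$ the gradient of $V$. A hyperbolic orbit of the system is a function $u:\mathbb{R}\to\mathbb{R}^{N}\setminus\{0\}$ satisfying both equations of the system for all $t\in\mathbb{R}$ and such that $|u(t)|\to\infty$ as $t\to+\infty$ and as $t\to-\infty$. *)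

theory Defs
  imports "HOL-Analysis.Analysis"
begin

(* Meaningful only at points of differentiability, where the described vector exists uniquely. *)
definition gradient :: "('a::euclidean_space \<Rightarrow> real) \<Rightarrow> 'a \<Rightarrow> 'a" where
  "gradient f x = (THE D. GDERIV f x :> D)"

lemma GDERIV_unique:
  fixes f :: "'a::euclidean_space \<Rightarrow> real"
  assumes "GDERIV f x :> D" and "GDERIV f x :> E"
  shows "D = E"
proof -
  have "(\<lambda>h. h \<bullet> D) = (\<lambda>h. h \<bullet> E)"
    using assms unfolding gderiv_def by (rule has_derivative_unique)
  then show ?thesis
    by (metis inner_commute vector_eq_rdot)
qed

lemma gradient_eqI:
  fixes f :: "'a::euclidean_space \<Rightarrow> real"
  assumes "GDERIV f x :> D"
  shows "gradient f x = D"
  unfolding gradient_def using assms GDERIV_unique by blast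

lemma GDERIV_gradient:
  fixes f :: "'a::euclidean_space \<Rightarrow> real"
  assumes "f differentiable (at x)"
  shows "GDERIV f x :> gradient f x"
proof -
  obtain f' where f': "(f has_derivative f') (at x)"
    using assms by (auto simp: differentiable_def)
  then have "linear f'"
    by (rule has_derivative_linear)
  then have "f' = (\<lambda>h. h \<bullet> adjoint f' 1)"
    by (simp add: adjoint_works)
  then have "GDERIV f x :> adjoint f' 1"
    using f' by (simp add: gderiv_def)
  then show ?thesis
    using gradient_eqI by metis
qed

(* Intended for open S: differentiability is required in a full neighbourhood sense. *)
definition C1_on :: "'a::euclidean_space set \<Rightarrow> ('a \<Rightarrow> real) \<Rightarrow> bool" where
  "C1_on S f \<longleftrightarrow> (\<forall>x\<in>S. f differentiable (at x)) \<and> continuous_on S (gradient f)"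

definition hyperbolic_orbit ::
    "('a::euclidean_space \<Rightarrow> real) \<Rightarrow> real \<Rightarrow> (real \<Rightarrow> 'a) \<Rightarrow> bool" where
  "hyperbolic_orbit V H u \<longleftrightarrow>
     (\<forall>t. u t \<noteq> 0) \<and>
     (\<exists>u' u''.
        (\<forall>t. (u has_vector_derivative u' t) (at t)) \<and>
        (\<forall>t. (u' has_vector_derivative u'' t) (at t)) \<and>
        (\<forall>t. u'' t + gradient V (u t) = 0) \<and>
        (\<forall>t. 1/2 * (norm (u' t))\<^sup>2 + V (u t) = H)) \<and>
     filterlim (\<lambda>t. norm (u t)) at_top at_top \<and>
     filterlim (\<lambda>t. norm (u t)) at_top at_bot"

end

theory Submission
  imports Defs "HOL-Real_Asymp.Real_Asymp"
begin

text \<open>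
  By Euler's identity \<open>V\<close> is homogeneous of degree \<open>-\<alpha>\<close>. At a minimiser \<open>\<xi>\<close> of \<open>V\<close> on the unit
  sphere, and hence along the whole ray through \<open>\<xi>\<close>, the force is radial, so there are orbits of
  the form \<open>\<rho>(t) \<xi>\<close>. The energy equation \<open>\<rho>'\<^sup>2 / 2 + V(\<xi>) \<rho>\<^sup>-\<^sup>\<alpha> = H\<close> becomes regular at the
  turning point under the substitution \<open>\<rho> = R cosh(w)\<^bsup>2/\<alpha>\<^esup>\<close> with \<open>R\<^sup>\<alpha> = V(\<xi>) / H\<close>: then
  \<open>\<rho>' = \<surd>(2 H) tanh w\<close> as soon as \<open>w\<close> solves a scalar equation \<open>w' = 1 / g(w)\<close>,
  where \<open>g\<close> is continuous and bounded below by a positive constant.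
  Such a \<open>w\<close> is the inverse function of an antiderivative of \<open>g\<close>.
\<close>

text \<open>The lower bound \<open>k\<close> makes an antiderivative \<open>T\<close> of
  \<open>g\<close> grow at least linearly, so \<open>T\<close> is an increasing bijection of the
  line. Its inverse is therefore defined for all times and has derivative \<open>1 / g\<close> along
  itself.\<close>

lemma scalar_autonomous_ode_global:
  fixes g :: "real \<Rightarrow> real"
  assumes cont: "continuous_on UNIV g" and k: "k > 0" and ge: "\<And>y. g y \<ge> k"
  obtains w where "\<And>t. (w has_real_derivative inverse (g (w t))) (at t)"
    and "filterlim w at_top at_top" and "filterlim w at_bot at_bot"
proof -
  have "\<exists>T. \<forall>x::real. -\<infinity> < ereal x \<longrightarrow> ereal x < \<infinity> \<longrightarrow> (T has_vector_derivative g x) (at x)"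
    using cont by (intro einterval_antiderivative) (auto simp: continuous_on_eq_continuous_at)
  then obtain T where T: "\<And>x. (T has_real_derivative g x) (at x)"
    by (auto simp: has_real_derivative_iff_has_vector_derivative)
  have growth: "T y - T x \<ge> k * (y - x)" if "x \<le> y" for x y
  proof -
    have "T x - k * x \<le> T y - k * y"
    proof (rule DERIV_nonneg_imp_nondecreasing[OF that])
      fix z
      have "((\<lambda>z. T z - k * z) has_real_derivative g z - k) (at z)"
        by (auto intro!: derivative_eq_intros T)
      then show "\<exists>D. ((\<lambda>z. T z - k * z) has_real_derivative D) (at z) \<and> 0 \<le> D"
        using ge[of z] by (intro exI[of _ "g z - k"]) simp
    qed
    then show ?thesis by (simp add: algebra_simps)
  qed
  have mono: "T x < T y" if "x < y" for x y
    using growth[of x y] that k mult_pos_pos[of k "y - x"] by linarith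
  have T_cont: "isCont T x" for x
    using T DERIV_isCont by blast
  have "\<exists>x. T x = t" for t
  proof -
    \<comment> \<open>With this \<open>b\<close>, the growth estimate moves \<open>T\<close> by at
      least \<bar>t - T 0\<bar> on either side of 0, so \<open>T (-b)\<close> and \<open>T b\<close>
      enclose \<open>t\<close>.\<close>
    define b where "b = \<bar>t - T 0\<bar> / k"
    have "b \<ge> 0" and kb: "k * b = \<bar>t - T 0\<bar>"
      using k by (auto simp: b_def)
    then have "T (-b) \<le> t" "t \<le> T b"
      using growth[of 0 b] growth[of "-b" 0] by auto
    then show ?thesis
      using IVT[of T "-b" t b] T_cont \<open>b \<ge> 0\<close> by auto
  qed
  then obtain w where w: "\<And>t. T (w t) = t"
    by metis
  have wT: "w (T x) = x" for x
    using mono[of "w (T x)" x] mono[of x "w (T x)"] w[of "T x"] by fastforce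
  have w_mono: "w s \<le> w t" if "s \<le> t" for s t
    using mono[of "w t" "w s"] w that by (metis not_less)
  show ?thesis
  proof
    fix t
    \<comment> \<open>The inverse function rule for derivatives needs continuity of the inverse
      beforehand.\<close>
    have "isCont w (T (w t))"
      by (rule isCont_inverse_function[where d = 1]) (auto simp: wT T_cont)
    then have "isCont w t" by (simp add: w)
    then show "(w has_real_derivative inverse (g (w t))) (at t)"
      using ge[of "w t"] k w
      by (intro DERIV_inverse_function[where a = "t - 1" and b = "t + 1", OF T]) auto
  next
    show "filterlim w at_top at_top"
      unfolding filterlim_at_top eventually_at_top_linorder using w_mono wT by metis
    show "filterlim w at_bot at_bot"
      unfolding filterlim_at_bot eventually_at_bot_linorder using w_mono wT by metis
  qed
qed

text \<open>Along a ray, Euler's identity makes the derivative of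
  \<open>s powr (-c) * V (s *\<^sub>R x)\<close> vanish; comparing the constant value at
  \<open>s\<close> and at 1 gives the claim.\<close>

lemma euler_identity_imp_homogeneous:
  fixes V :: "'a::euclidean_space \<Rightarrow> real"
  assumes diff: "\<And>y. y \<noteq> 0 \<Longrightarrow> V differentiable (at y)"
    and euler: "\<And>y. y \<noteq> 0 \<Longrightarrow> y \<bullet> gradient V y = c * V y"
    and "x \<noteq> 0" "s > 0"
  shows "V (s *\<^sub>R x) = s powr c * V x"
proof -
  have D: "((\<lambda>s. s powr (-c) * V (s *\<^sub>R x)) has_real_derivative 0) (at s)" if "s > 0" for s
  proof -
    let ?y = "s *\<^sub>R x"
    have V: "(V has_derivative (\<lambda>h. h \<bullet> gradient V ?y)) (at ?y)"
      using GDERIV_gradient[OF diff[of ?y]] \<open>x \<noteq> 0\<close> that by (simp add: gderiv_def)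
    have "((\<lambda>s. s *\<^sub>R x) has_derivative (\<lambda>h. h *\<^sub>R x)) (at s)"
      by (auto intro!: derivative_eq_intros)
    from has_derivative_compose[OF this V]
    have "((\<lambda>s. V (s *\<^sub>R x)) has_derivative (\<lambda>h. (h *\<^sub>R x) \<bullet> gradient V ?y)) (at s)" .
    then have 1: "((\<lambda>s. V (s *\<^sub>R x)) has_real_derivative (x \<bullet> gradient V ?y)) (at s)"
      by (rule has_derivative_imp_has_field_derivative) simp
    have 2: "x \<bullet> gradient V ?y = c * V ?y / s"
      using euler[of ?y] \<open>x \<noteq> 0\<close> that by (simp add: field_simps)
    show ?thesis
      using that
      by (auto intro!: derivative_eq_intros 1 simp: 2 powr_diff field_simps)
  qed
  have "\<exists>K. \<forall>s\<in>{0<..}. s powr (-c) * V (s *\<^sub>R x) = K"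
    by (rule has_field_derivative_zero_constant)
       (auto intro!: D DERIV_subset[OF D])
  then obtain K where K: "\<And>s. s > 0 \<Longrightarrow> s powr (-c) * V (s *\<^sub>R x) = K"
    by auto
  show ?thesis
    using K[OF \<open>s > 0\<close>] K[of 1] \<open>s > 0\<close> by (simp add: powr_minus field_simps)
qed

text \<open>Dividing out the homogeneity leaves a function whose gradient vanishes along a whole ray
  of minimisers; the product rule then leaves only a radial term in the gradient of
  \<open>V\<close>.\<close>

lemma homogeneous_radial_gradient_ray:
  fixes V :: "'a::euclidean_space \<Rightarrow> real"
  assumes diff: "\<And>y. y \<noteq> 0 \<Longrightarrow> V differentiable (at y)"
    and hom: "\<And>s y. s > 0 \<Longrightarrow> y \<noteq> 0 \<Longrightarrow> V (s *\<^sub>R y) = s powr c * V y"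
  obtains \<xi> where "norm \<xi> = 1"
    and "\<And>r. r > 0 \<Longrightarrow> gradient V (r *\<^sub>R \<xi>) = (c * V (r *\<^sub>R \<xi>) / r) *\<^sub>R \<xi>"
proof -
  have "continuous_on (sphere 0 1) V"
    by (intro continuous_at_imp_continuous_on ballI differentiable_imp_continuous_within diff) auto
  then obtain \<xi> where \<xi>: "norm \<xi> = 1" and min: "\<And>y. norm y = 1 \<Longrightarrow> V \<xi> \<le> V y"
    using continuous_attains_inf[of "sphere (0::'a) 1" V] by auto
  \<comment> \<open>\<open>W\<close> is homogeneous of degree 0, so it is minimal at every point of the ray through \<open>\<xi>\<close>.\<close>
  define W where "W y = norm y powr (-c) * V y" for y
  have W: "W y = V (sgn y)" if "y \<noteq> 0" for y
    using hom[of "norm y" "sgn y"] that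
    by (simp add: W_def sgn_div_norm powr_minus)
  show thesis
  proof
    show "norm \<xi> = 1" by (rule \<xi>)
    fix r :: real assume r: "r > 0"
    let ?p = "r *\<^sub>R \<xi>"
    have p: "?p \<noteq> 0" "norm ?p = r" "sgn ?p = \<xi>"
      using \<xi> r by (auto simp: sgn_div_norm)
    let ?D = "norm ?p powr (-c) *\<^sub>R gradient V ?p
      + V ?p *\<^sub>R ((-c * norm ?p powr (-c - 1)) *\<^sub>R sgn ?p)"
    have N: "GDERIV (\<lambda>y. norm y powr (-c)) ?p :> (-c * norm ?p powr (-c - 1)) *\<^sub>R sgn ?p"
      using p r by (intro GDERIV_DERIV_compose[OF GDERIV_norm])
        (auto intro!: derivative_eq_intros)
    have "GDERIV W ?p :> ?D"
      unfolding W_def by (rule GDERIV_mult[OF N GDERIV_gradient[OF diff[OF p(1)]]])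
    then have "(W has_derivative (\<lambda>h. h \<bullet> ?D)) (at ?p)"
      by (simp add: gderiv_def)
    moreover have "\<forall>y\<in>-{0}. W ?p \<le> W y"
      using W p min by (auto simp: norm_sgn)
    ultimately have "(\<lambda>h. h \<bullet> ?D) = (\<lambda>h. 0)"
      using p by (intro differential_zero_maxmin[where S = "-{0}"]) auto
    \<comment> \<open>The vanishing functional is evaluated at \<open>?D\<close> itself.\<close>
    then have "?D \<bullet> ?D = 0" by meson
    then have "?D = 0" by simp
    then have "r powr (-c) *\<^sub>R gradient V ?p = r powr (-c) *\<^sub>R ((c * V ?p / r) *\<^sub>R \<xi>)"
      using r unfolding p by (simp add: powr_diff algebra_simps)
    then show "gradient V ?p = (c * V ?p / r) *\<^sub>R \<xi>"
      by (rule scaleR_left_imp_eq[rotated]) (use r in simp)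
  qed
qed

lemma cosh_powr_at_top:
  assumes "(a::real) > 0"
  shows "filterlim (\<lambda>x::real. cosh x powr a) at_top at_top"
    and "filterlim (\<lambda>x::real. cosh x powr a) at_top at_bot"
proof -
  show top: "filterlim (\<lambda>x::real. cosh x powr a) at_top at_top"
    using filterlim_compose[OF real_powr_at_top[OF assms] cosh_real_at_top] .
  show "filterlim (\<lambda>x::real. cosh x powr a) at_top at_bot"
    using filterlim_compose[OF top filterlim_uminus_at_top_at_bot] by simp
qed

theorem theorem1p4:
  fixes V :: "real ^ 'n \<Rightarrow> real"
  assumes "C1_on (UNIV - {0}) V"
    and "\<forall>x. x \<noteq> 0 \<longrightarrow> V (- x) = V x"
    and "\<exists>\<alpha>::real. 0 < \<alpha> \<and> \<alpha> < 2 \<and>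
           (\<forall>x. x \<noteq> 0 \<longrightarrow> x \<bullet> gradient V x = - \<alpha> * V x \<and> - \<alpha> * V x < 0)"
  shows "\<forall>H>0. \<exists>u :: real \<Rightarrow> real ^ 'n. hyperbolic_orbit V H u"
proof (intro allI impI)
  fix H :: real assume H: "H > 0"
  have diff: "V differentiable (at y)" if "y \<noteq> 0" for y
    using assms(1) that by (auto simp: C1_on_def)
  obtain \<alpha> where \<alpha>: "\<alpha> > 0" and euler: "\<And>y. y \<noteq> 0 \<Longrightarrow> y \<bullet> gradient V y = - \<alpha> * V y"
    and "\<And>y. y \<noteq> 0 \<Longrightarrow> - \<alpha> * V y < 0"
    using assms(3) by blast
  then have pos: "V y > 0" if "y \<noteq> 0" for y
    using that by (simp add: zero_less_mult_iff)
  have hom: "V (s *\<^sub>R y) = s powr (-\<alpha>) * V y" if "s > 0" "y \<noteq> 0" for s y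
    using euler_identity_imp_homogeneous[OF diff euler that(2,1)] .
  obtain \<xi> where \<xi>: "norm \<xi> = 1"
    and grad: "\<And>r. r > 0 \<Longrightarrow> gradient V (r *\<^sub>R \<xi>) = (- \<alpha> * V (r *\<^sub>R \<xi>) / r) *\<^sub>R \<xi>"
    using homogeneous_radial_gradient_ray[OF diff hom] by blast
  have "\<xi> \<noteq> 0" using \<xi> by auto
  \<comment> \<open>The turning radius: all energy is potential there, that is,
    \<open>V (R *\<^sub>R \<xi>) = H\<close>.\<close>
  define R where "R = (V \<xi> / H) powr (1 / \<alpha>)"
  have R: "R > 0" using pos[OF \<open>\<xi> \<noteq> 0\<close>] H by (simp add: R_def)
  have "R powr \<alpha> = V \<xi> / H"
    using pos[OF \<open>\<xi> \<noteq> 0\<close>] H \<alpha> by (simp add: R_def powr_powr)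
  then have RV: "R powr (-\<alpha>) * V \<xi> = H"
    using R H by (simp add: powr_minus field_simps)
  \<comment> \<open>Differentiating \<open>R * ?c (w t)\<close> with \<open>w' = k / ?c w\<close>
    gives \<open>(2 * R * k / \<alpha>) * tanh w\<close>; this \<open>k\<close> makes the factor
    \<open>sqrt (2 * H)\<close>.\<close>
  define k where "k = sqrt (2 * H) * \<alpha> / (2 * R)"
  have k: "k > 0" using H \<alpha> R by (simp add: k_def)
  let ?c = "\<lambda>y::real. cosh y powr (2 / \<alpha>)"
  have c_ge: "?c y \<ge> 1" for y
    using \<alpha> by (simp add: ge_one_powr_ge_zero cosh_real_ge_1)
  have "continuous_on UNIV (\<lambda>y. ?c y / k)"
    using k by (intro continuous_intros) auto
  then obtain w where w: "\<And>t. (w has_real_derivative inverse (?c (w t) / k)) (at t)"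
    and w_lim: "filterlim w at_top at_top" "filterlim w at_bot at_bot"
    using scalar_autonomous_ode_global[of "\<lambda>y. ?c y / k" "1 / k"] k c_ge
    by (auto simp: divide_right_mono)
  define \<rho> where "\<rho> t = R * ?c (w t)" for t
  have \<rho>: "\<rho> t > 0" for t using R by (simp add: \<rho>_def)
  \<comment> \<open>The exponent 2 / \<alpha> is chosen so that degree -\<alpha> turns into the
    power -2 of cosh; the potential energy then complements the kinetic energy
    \<open>H * (tanh (w t))\<^sup>2\<close>.\<close>
  have V\<rho>: "V (\<rho> t *\<^sub>R \<xi>) = H / (cosh (w t))\<^sup>2" for t
  proof -
    have "\<rho> t powr (-\<alpha>) = R powr (-\<alpha>) * cosh (w t) powr (-2)"
      using R \<alpha> by (simp add: \<rho>_def powr_mult powr_powr)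
    also have "cosh (w t) powr (-2) = 1 / (cosh (w t))\<^sup>2"
      by (simp add: powr_minus powr_numeral divide_inverse)
    finally show ?thesis
      using hom[OF \<rho>[of t] \<open>\<xi> \<noteq> 0\<close>] RV by (simp add: field_simps)
  qed
  have \<rho>': "(\<rho> has_real_derivative sqrt (2 * H) * tanh (w t)) (at t)" for t
  proof -
    have "(\<rho> has_real_derivative R * (2 / \<alpha> * cosh (w t) powr (2 / \<alpha> - 1)
        * (sinh (w t) * inverse (?c (w t) / k)))) (at t)"
      unfolding \<rho>_def by (auto intro!: derivative_eq_intros w)
    moreover have "cosh (w t) powr (2 / \<alpha> - 1) = ?c (w t) / cosh (w t)"
      by (simp add: powr_diff)
    then have "R * (2 / \<alpha> * cosh (w t) powr (2 / \<alpha> - 1)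
        * (sinh (w t) * inverse (?c (w t) / k))) = sqrt (2 * H) * tanh (w t)"
      using R \<alpha> by (simp add: tanh_def k_def)
    ultimately show ?thesis by simp
  qed
  have tanh_sq: "(tanh y)\<^sup>2 = 1 - 1 / (cosh y)\<^sup>2" for y :: real
    by (simp add: tanh_def power_divide sinh_square_eq diff_divide_distrib)
  \<comment> \<open>By \<open>V\<rho>\<close> this derivative is \<alpha> times the potential energy
    divided by \<open>\<rho> t\<close>, which is exactly the radial force given by
    \<open>grad\<close>.\<close>
  have \<rho>'': "((\<lambda>t. sqrt (2 * H) * tanh (w t)) has_real_derivative
      \<alpha> * (H / (cosh (w t))\<^sup>2) / \<rho> t) (at t)" for t
  proof -
    have D: "((\<lambda>t. sqrt (2 * H) * tanh (w t)) has_real_derivative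
        sqrt (2 * H) * ((1 - (tanh (w t))\<^sup>2) * inverse (?c (w t) / k))) (at t)"
      by (auto intro!: derivative_eq_intros w)
    have sqrt_k: "sqrt (2 * H) * k = \<alpha> * H / R"
      using H by (simp add: k_def flip: mult.assoc)
    have "sqrt (2 * H) * ((1 - (tanh (w t))\<^sup>2) * inverse (?c (w t) / k))
        = (sqrt (2 * H) * k) / ((cosh (w t))\<^sup>2 * ?c (w t))"
      by (simp add: tanh_sq)
    also have "\<dots> = \<alpha> * (H / (cosh (w t))\<^sup>2) / \<rho> t"
      unfolding sqrt_k \<rho>_def by simp
    finally show ?thesis using D by simp
  qed
  define u where "u t = \<rho> t *\<^sub>R \<xi>" for t
  have norm_u: "norm (u t) = R * ?c (w t)" for t
    using \<xi> R by (simp add: u_def \<rho>_def)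
  have energy: "1/2 * (norm ((sqrt (2 * H) * tanh (w t)) *\<^sub>R \<xi>))\<^sup>2 + V (u t) = H" for t
    using H \<xi> by (simp add: u_def V\<rho> power_mult_distrib tanh_sq algebra_simps)
  have "hyperbolic_orbit V H u"
    unfolding hyperbolic_orbit_def
  proof (intro conjI exI allI)
    fix t
    show "u t \<noteq> 0" using \<rho>[of t] \<open>\<xi> \<noteq> 0\<close> by (simp add: u_def)
    show "(u has_vector_derivative (sqrt (2 * H) * tanh (w t)) *\<^sub>R \<xi>) (at t)"
      unfolding u_def using has_vector_derivative_scaleR[OF \<rho>' has_vector_derivative_const] by simp
    show "((\<lambda>t. (sqrt (2 * H) * tanh (w t)) *\<^sub>R \<xi>) has_vector_derivative
        (\<alpha> * (H / (cosh (w t))\<^sup>2) / \<rho> t) *\<^sub>R \<xi>) (at t)"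
      using has_vector_derivative_scaleR[OF \<rho>'' has_vector_derivative_const] by simp
    show "(\<alpha> * (H / (cosh (w t))\<^sup>2) / \<rho> t) *\<^sub>R \<xi> + gradient V (u t) = 0"
      unfolding u_def grad[OF \<rho>] V\<rho> by simp
    show "1/2 * (norm ((sqrt (2 * H) * tanh (w t)) *\<^sub>R \<xi>))\<^sup>2 + V (u t) = H"
      by (rule energy)
  next
    \<comment> \<open>Since cosh is even, its power blows up at both ends, so the orbit escapes in
      both time directions.\<close>
    have c_lim: "filterlim ?c at_top at_top" "filterlim ?c at_top at_bot"
      using \<alpha> by (auto intro!: cosh_powr_at_top)
    show "filterlim (\<lambda>t. norm (u t)) at_top at_top"
      unfolding norm_u using filterlim_compose[OF c_lim(1) w_lim(1)] R
      by (intro filterlim_tendsto_pos_mult_at_top[OF tendsto_const])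
    show "filterlim (\<lambda>t. norm (u t)) at_top at_bot"
      unfolding norm_u using filterlim_compose[OF c_lim(2) w_lim(2)] R
      by (intro filterlim_tendsto_pos_mult_at_top[OF tendsto_const])
  qed
  then show "\<exists>u :: real \<Rightarrow> real ^ 'n. hyperbolic_orbit V H u"
    by blast
qed

end
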